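(* Let $w \in S_n$ be a fully commutative permutation. Then there exist permutations $\hat{w}, w' \in S_n$ such that $w = \hat{w} w'$, $\ell(w) = \ell(\hat{w}) + \ell(w')$, the permutation $\hat{w}$ is boolean, and $\operatorname{supp}(\hat{w}) = \operatorname{supp}(w)$. Furthermore, such a $\hat{w}$ is uniquely determined by $w$.
   Context: $S_n$ is the symmetric group, generated by the simple reflections $s_1,\dots,s_{n-1}$, where $s_i$ swaps $i$ and $i+1$. The length $\ell(w)$ is the minimum number of simple reflections in an expression for $w$ (equivalently, the number of inversions of $w$). A reduced word of $w$ is a word $i_1\cdots i_{\ell(w)}$ with $w = s_{i_1}\cdots s_{i_{\ell(w)}}$. The support $\operatorname{supp}(w)$ is the set of letters appearing in reduced words of $w$. A permutation is fully commutative if any two of its reduced words are related by a sequence of commutation moves $s_is_j=s_js_i$ ($|i-j|>1$); equivalently, it avoids the pattern $321$. A permutation is boolean if it avoids the patterns $321$ and $3412$; equivalently, some (equivalently every) reduced word of it consists of distinct letters. *)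

theory Defs
  imports "HOL-Combinatorics.Permutations"
begin

text \<open>
  An element of \<open>S\<^sub>n\<close> is a function \<open>w :: nat \<Rightarrow> nat\<close> with \<open>w permutes {1..n}\<close>;
  the group product is composition of functions.
\<close>

definition simple_refl :: "nat \<Rightarrow> nat \<Rightarrow> nat" where
  "simple_refl i = Transposition.transpose i (Suc i)"

definition word_prod :: "nat list \<Rightarrow> nat \<Rightarrow> nat" where
  "word_prod is = foldr (\<lambda>i f. simple_refl i \<circ> f) is id"

definition is_word :: "nat \<Rightarrow> (nat \<Rightarrow> nat) \<Rightarrow> nat list \<Rightarrow> bool" where
  "is_word n w is \<longleftrightarrow> set is \<subseteq> {1..<n} \<and> w = word_prod is"

text \<open>Meaningful only for \<open>w permutes {1..n}\<close>, where some word for \<open>w\<close> exists.\<close>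

definition perm_len :: "nat \<Rightarrow> (nat \<Rightarrow> nat) \<Rightarrow> nat" where
  "perm_len n w = (LEAST k. \<exists>is. is_word n w is \<and> length is = k)"

definition reduced_word :: "nat \<Rightarrow> (nat \<Rightarrow> nat) \<Rightarrow> nat list \<Rightarrow> bool" where
  "reduced_word n w is \<longleftrightarrow> is_word n w is \<and> length is = perm_len n w"

definition supp :: "nat \<Rightarrow> (nat \<Rightarrow> nat) \<Rightarrow> nat set" where
  "supp n w = {i. \<exists>is. reduced_word n w is \<and> i \<in> set is}"

inductive commutation_move :: "nat list \<Rightarrow> nat list \<Rightarrow> bool" where
  "\<bar>int i - int j\<bar> > 1 \<Longrightarrow> commutation_move (us @ [i, j] @ vs) (us @ [j, i] @ vs)"

definition fully_commutative :: "nat \<Rightarrow> (nat \<Rightarrow> nat) \<Rightarrow> bool" where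
  "fully_commutative n w \<longleftrightarrow>
     (\<forall>is js. reduced_word n w is \<longrightarrow> reduced_word n w js \<longrightarrow> commutation_move\<^sup>*\<^sup>* is js)"

text \<open>
  The pattern \<open>p\<close> is given in one-line notation; \<open>f 0 < f 1 < \<dots>\<close> are the positions in
  \<open>{1..n}\<close> at which \<open>w(1) \<dots> w(n)\<close> has a subsequence order-isomorphic to \<open>p\<close>.
\<close>

definition contains_pattern :: "nat \<Rightarrow> (nat \<Rightarrow> nat) \<Rightarrow> nat list \<Rightarrow> bool" where
  "contains_pattern n w p \<longleftrightarrow>
     (\<exists>f. strict_mono_on {..<length p} f \<and> f ` {..<length p} \<subseteq> {1..n} \<and>
          (\<forall>a<length p. \<forall>b<length p. w (f a) < w (f b) \<longleftrightarrow> p ! a < p ! b))"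

definition boolean_perm :: "nat \<Rightarrow> (nat \<Rightarrow> nat) \<Rightarrow> bool" where
  "boolean_perm n w \<longleftrightarrow>
     \<not> contains_pattern n w [3, 2, 1] \<and> \<not> contains_pattern n w [3, 4, 1, 2]"

end

theory Submission
  imports Defs "HOL-Library.Multiset"
begin

text \<open>
  In a reduced word of a fully commutative permutation, both neighbours of a letter \<open>j\<close> occur
  between any two occurrences of \<open>j\<close>; otherwise commutations would produce a factor \<open>jj\<close> or
  \<open>jkj\<close>, and a braid move on the latter changes the multiset of letters. Hence the first
  occurrences of the letters can be moved to the front by commutations, which gives the
  factorization. The product of the first occurrences does not change under commutation moves, and
  a boolean left factor of full support is the subword of first occurrences of the concatenated
  reduced word, which gives uniqueness. That reduced words of boolean permutations have distinct
  letters is seen by counting, for each \<open>k\<close>, the \<open>x \<le> k\<close> with \<open>w x > k\<close>.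
\<close>

section \<open>Words in simple reflections\<close>

lemma word_prod_Nil [simp]: "word_prod [] = id"
  by (simp add: word_prod_def)

lemma word_prod_Cons [simp]: "word_prod (i # xs) = simple_refl i \<circ> word_prod xs"
  by (simp add: word_prod_def)

lemma word_prod_append [simp]: "word_prod (xs @ ys) = word_prod xs \<circ> word_prod ys"
  by (induction xs) (simp_all add: o_assoc)

lemma simple_refl_apply:
  "simple_refl i x = (if x = i then Suc i else if x = Suc i then i else x)"
  by (simp add: simple_refl_def Transposition.transpose_def)

lemma simple_refl_comp_self [simp]: "simple_refl i \<circ> simple_refl i = id"
  by (auto simp: simple_refl_apply)

lemma simple_refl_comm:
  assumes "j \<noteq> Suc i" "i \<noteq> Suc j"
  shows "simple_refl i \<circ> simple_refl j = simple_refl j \<circ> simple_refl i"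
  using assms by (auto simp: simple_refl_apply fun_eq_iff)

lemma simple_refl_braid:
  assumes "j = Suc i \<or> i = Suc j"
  shows "simple_refl i \<circ> (simple_refl j \<circ> simple_refl i) =
         simple_refl j \<circ> (simple_refl i \<circ> simple_refl j)"
  using assms by (auto simp: simple_refl_apply fun_eq_iff)

lemma word_prod_comm:
  assumes "\<forall>b\<in>set xs. b \<noteq> Suc a \<and> a \<noteq> Suc b"
  shows "word_prod xs \<circ> simple_refl a = simple_refl a \<circ> word_prod xs"
  using assms
proof (induction xs)
  case (Cons b xs)
  have "word_prod (b # xs) \<circ> simple_refl a = simple_refl b \<circ> (word_prod xs \<circ> simple_refl a)"
    by (simp add: o_assoc)
  also have "word_prod xs \<circ> simple_refl a = simple_refl a \<circ> word_prod xs"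
    using Cons.prems by (intro Cons.IH) auto
  also have "simple_refl b \<circ> (simple_refl a \<circ> word_prod xs) =
      (simple_refl b \<circ> simple_refl a) \<circ> word_prod xs"
    by (rule o_assoc)
  also have "simple_refl b \<circ> simple_refl a = simple_refl a \<circ> simple_refl b"
    using Cons.prems by (intro simple_refl_comm) auto
  finally show ?case by (simp add: o_assoc)
qed simp

lemma simple_refl_permutes: "i \<in> {1..<n} \<Longrightarrow> simple_refl i permutes {1..n}"
  unfolding simple_refl_def by (rule permutes_swap_id) auto

lemma word_prod_permutes: "set xs \<subseteq> {1..<n} \<Longrightarrow> word_prod xs permutes {1..n}"
proof (induction xs)
  case (Cons i xs)
  then have "simple_refl i permutes {1..n}"
    by (intro simple_refl_permutes) auto
  moreover have "word_prod xs permutes {1..n}"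
    using Cons by simp
  ultimately show ?case
    unfolding word_prod_Cons by (intro permutes_compose)
qed (simp add: permutes_id)

lemma inj_word_prod: "inj (word_prod xs)"
proof (induction xs)
  case (Cons i xs)
  have "inj (simple_refl i)" by (simp add: simple_refl_def)
  with Cons show ?case unfolding word_prod_Cons by (rule inj_compose[rotated])
qed simp

text \<open>Conjugating the transposition of \<open>a\<close> and \<open>b\<close> by
  \<open>simple_refl b\<close> gives that of \<open>a\<close> and \<open>Suc b\<close>.\<close>

lemma transpose_eq_word_prod:
  assumes "a < b"
  shows "\<exists>xs. set xs \<subseteq> {a..<b} \<and> Transposition.transpose a b = word_prod xs"
  using assms
proof (induction b)
  case (Suc b)
  show ?case
  proof (cases "a = b")
    case True
    then show ?thesis by (intro exI[of _ "[b]"]) (simp add: simple_refl_def)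
  next
    case False
    with Suc obtain xs where xs: "set xs \<subseteq> {a..<b}" "Transposition.transpose a b = word_prod xs"
      by auto
    have "Transposition.transpose a (Suc b) = simple_refl b \<circ> (Transposition.transpose a b \<circ> simple_refl b)"
      using Suc.prems False by (auto simp: fun_eq_iff simple_refl_apply Transposition.transpose_def)
    with xs have "Transposition.transpose a (Suc b) = word_prod (b # xs @ [b])" by simp
    moreover have "set (b # xs @ [b]) \<subseteq> {a..<Suc b}" using xs Suc.prems by auto
    ultimately show ?thesis by blast
  qed
qed simp

lemma ex_is_word:
  assumes "w permutes {1..n}"
  shows "\<exists>xs. is_word n w xs"
  using assms finite_atLeastAtMost
proof (induction rule: permutes_induct)
  case id
  then show ?case by (auto simp: is_word_def intro!: exI[of _ "[]"])
next
  case (swap a b p)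
  then obtain xs where xs: "is_word n p xs" by blast
  \<comment> \<open>\<open>transpose_eq_word_prod\<close> expects ordered arguments, and a
    transposition is symmetric in them.\<close>
  define c d where "c = min a b" and "d = max a b"
  have cd: "c < d" "c \<ge> 1" "d \<le> n" using swap by (auto simp: c_def d_def)
  obtain ys where ys: "set ys \<subseteq> {c..<d}" "Transposition.transpose c d = word_prod ys"
    using transpose_eq_word_prod[OF cd(1)] by blast
  have "Transposition.transpose a b = word_prod ys"
    using ys(2) by (auto simp: c_def d_def min_def max_def transpose_commute split: if_splits)
  then have "is_word n (Transposition.transpose a b \<circ> p) (ys @ xs)"
    using xs ys(1) cd by (auto simp: is_word_def)
  then show ?case by blast
qed

section \<open>Length and reduced words\<close>

lemma perm_len_le: "is_word n w xs \<Longrightarrow> perm_len n w \<le> length xs"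
  unfolding perm_len_def by (rule Least_le) blast

lemma ex_reduced_word:
  assumes "w permutes {1..n}"
  shows "\<exists>xs. reduced_word n w xs"
  using LeastI_ex[of "\<lambda>k. \<exists>xs. is_word n w xs \<and> length xs = k"] ex_is_word[OF assms]
  unfolding reduced_word_def perm_len_def by blast

lemma reduced_word_length_le:
  assumes "reduced_word n (word_prod xs) xs" "set ys \<subseteq> {1..<n}" "word_prod xs = word_prod ys"
  shows "length xs \<le> length ys"
  using assms perm_len_le[of n "word_prod xs" ys] by (simp add: reduced_word_def is_word_def)

lemma reduced_word_eq: "reduced_word n w xs \<Longrightarrow> w = word_prod xs"
  by (simp add: reduced_word_def is_word_def)

lemma reduced_word_subset: "reduced_word n w xs \<Longrightarrow> set xs \<subseteq> {1..<n}"
  by (simp add: reduced_word_def is_word_def)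

lemma reduced_word_transfer:
  assumes "reduced_word n w xs" "word_prod ys = word_prod xs" "mset ys = mset xs"
  shows "reduced_word n w ys"
  using assms mset_eq_setD[OF assms(3)] mset_eq_length[OF assms(3)]
  by (simp add: reduced_word_def is_word_def)

text \<open>Shortest words of the two factors concatenate to a word of the whole product, which
  cannot be shorter than \<open>xs @ ys\<close>; so neither factor has a shorter word.\<close>

lemma reduced_word_appendD:
  assumes "reduced_word n (word_prod (xs @ ys)) (xs @ ys)"
  shows "reduced_word n (word_prod xs) xs" "reduced_word n (word_prod ys) ys"
proof -
  have sub: "set xs \<subseteq> {1..<n}" "set ys \<subseteq> {1..<n}"
    using reduced_word_subset[OF assms] by auto
  obtain us vs where us: "reduced_word n (word_prod xs) us" and vs: "reduced_word n (word_prod ys) vs"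
    using ex_reduced_word word_prod_permutes sub by meson
  have "length (xs @ ys) \<le> length (us @ vs)"
    using us vs by (intro reduced_word_length_le[OF assms]) (auto simp: reduced_word_def is_word_def)
  moreover have "length us \<le> length xs" "length vs \<le> length ys"
    using us vs sub perm_len_le[of n "word_prod xs" xs] perm_len_le[of n "word_prod ys" ys]
    by (auto simp: reduced_word_def is_word_def)
  ultimately have "length xs = length us" "length ys = length vs" by auto
  then show "reduced_word n (word_prod xs) xs" "reduced_word n (word_prod ys) ys"
    using us vs sub by (auto simp: reduced_word_def is_word_def)
qed

lemma reduced_word_append:
  assumes "reduced_word n u xs" "reduced_word n v ys"
    and "perm_len n (u \<circ> v) = perm_len n u + perm_len n v"
  shows "reduced_word n (u \<circ> v) (xs @ ys)"
  using assms by (simp add: reduced_word_def is_word_def)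

section \<open>The exchange property\<close>

text \<open>Reading the word from the right, the values at \<open>i\<close> and \<open>Suc i\<close>
  start in increasing order, so some letter reverses them. Deleting that letter has the same effect
  as multiplying by \<open>simple_refl i\<close> on the right.\<close>

lemma word_prod_exchange:
  assumes "word_prod xs (Suc i) < word_prod xs i"
  shows "\<exists>ys. set ys \<subseteq> set xs \<and> Suc (length ys) = length xs \<and>
              word_prod xs \<circ> simple_refl i = word_prod ys"
  using assms
proof (induction xs)
  case (Cons j q)
  have inj: "inj (word_prod q)"
    by (rule inj_word_prod)
  show ?case
  proof (cases "word_prod q (Suc i) < word_prod q i")
    case True
    then obtain ys where "set ys \<subseteq> set q" "Suc (length ys) = length q"
      "word_prod q \<circ> simple_refl i = word_prod ys"
      using Cons.IH by blast
    then show ?thesis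
      by (intro exI[of _ "j # ys"]) (auto simp: fun_eq_iff)
  next
    case False
    moreover have "word_prod q (Suc i) \<noteq> word_prod q i"
      using inj by (auto dest: injD)
    ultimately have "word_prod q i < word_prod q (Suc i)" by simp
    \<comment> \<open>The reflection in \<open>j\<close> reverses the order of two values only if
      they are \<open>j\<close> and \<open>Suc j\<close>.\<close>
    with Cons.prems have *: "word_prod q i = j" "word_prod q (Suc i) = Suc j"
      by (auto simp: simple_refl_apply split: if_splits)
    have "(word_prod (j # q) \<circ> simple_refl i) x = word_prod q x" for x
    proof -
      consider "x = i" | "x = Suc i" | "x \<noteq> i" "x \<noteq> Suc i" by blast
      then show ?thesis
      proof cases
        case 3
        then have "word_prod q x \<noteq> j" "word_prod q x \<noteq> Suc j"
          using * inj by (metis injD)+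
        with 3 show ?thesis by (simp add: simple_refl_apply)
      qed (use * in \<open>simp_all add: simple_refl_apply\<close>)
    qed
    then show ?thesis by (intro exI[of _ q]) (auto simp: fun_eq_iff)
  qed
qed simp

text \<open>If \<open>word_prod xs\<close> had a descent at \<open>i\<close>, exchange would give a
  word two letters shorter than \<open>xs @ [i]\<close>.\<close>

lemma reduced_word_snoc_less:
  assumes "reduced_word n (word_prod (xs @ [i])) (xs @ [i])"
  shows "word_prod xs i < word_prod xs (Suc i)"
proof (rule ccontr)
  have "word_prod xs i \<noteq> word_prod xs (Suc i)"
    using injD[OF inj_word_prod, of xs i "Suc i"] by auto
  moreover assume "\<not> ?thesis"
  ultimately obtain ys where ys: "set ys \<subseteq> set xs" "Suc (length ys) = length xs"
    "word_prod xs \<circ> simple_refl i = word_prod ys"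
    using word_prod_exchange by (metis linorder_neqE_nat)
  then have "length (xs @ [i]) \<le> length ys"
    using reduced_word_subset[OF assms] by (intro reduced_word_length_le[OF assms]) auto
  with ys show False by simp
qed

section \<open>Boolean permutations\<close>

lemma contains_321_iff:
  "contains_pattern n w [3, 2, 1] \<longleftrightarrow>
     (\<exists>a b c. 1 \<le> a \<and> a < b \<and> b < c \<and> c \<le> n \<and> w c < w b \<and> w b < w a)"
proof
  assume "contains_pattern n w [3, 2, 1]"
  then obtain f where f: "strict_mono_on {..<3::nat} f" "f ` {..<3} \<subseteq> {1..n}"
    and w: "\<forall>a<3. \<forall>b<3. w (f a) < w (f b) \<longleftrightarrow> [3, 2, 1::nat] ! a < [3, 2, 1] ! b"
    unfolding contains_pattern_def by (auto simp: numeral_3_eq_3)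
  have "f 0 < f 1" "f 1 < f 2" using f(1) by (auto simp: strict_mono_on_def)
  moreover have "1 \<le> f 0" "f 2 \<le> n" using f(2) by (auto simp: image_subset_iff)
  moreover have "w (f 2) < w (f 1)" "w (f 1) < w (f 0)"
    using w[rule_format, of 2 1] w[rule_format, of 1 0] by simp_all
  ultimately show "\<exists>a b c. 1 \<le> a \<and> a < b \<and> b < c \<and> c \<le> n \<and> w c < w b \<and> w b < w a" by blast
next
  assume "\<exists>a b c. 1 \<le> a \<and> a < b \<and> b < c \<and> c \<le> n \<and> w c < w b \<and> w b < w a"
  then obtain a b c where "1 \<le> a" "a < b" "b < c" "c \<le> n" "w c < w b" "w b < w a" by blast
  then show "contains_pattern n w [3, 2, 1]"
    unfolding contains_pattern_def
    by (intro exI[of _ "\<lambda>i. [a, b, c] ! i"])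
      (auto simp: strict_mono_on_def less_Suc_eq numeral_3_eq_3)
qed

lemma contains_3412_iff:
  "contains_pattern n w [3, 4, 1, 2] \<longleftrightarrow>
     (\<exists>a b c d. 1 \<le> a \<and> a < b \<and> b < c \<and> c < d \<and> d \<le> n \<and> w c < w d \<and> w d < w a \<and> w a < w b)"
proof
  assume "contains_pattern n w [3, 4, 1, 2]"
  then obtain f where f: "strict_mono_on {..<4::nat} f" "f ` {..<4} \<subseteq> {1..n}"
    and w: "\<forall>a<4. \<forall>b<4. w (f a) < w (f b) \<longleftrightarrow> [3, 4, 1, 2::nat] ! a < [3, 4, 1, 2] ! b"
    unfolding contains_pattern_def by (auto simp: eval_nat_numeral)
  have "f 0 < f 1" "f 1 < f 2" "f 2 < f 3" using f(1) by (auto simp: strict_mono_on_def)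
  moreover have "1 \<le> f 0" "f 3 \<le> n" using f(2) by (auto simp: image_subset_iff)
  moreover have "w (f 2) < w (f 3)" "w (f 3) < w (f 0)" "w (f 0) < w (f 1)"
    using w[rule_format, of 2 3] w[rule_format, of 3 0] w[rule_format, of 0 1] by simp_all
  ultimately show "\<exists>a b c d. 1 \<le> a \<and> a < b \<and> b < c \<and> c < d \<and> d \<le> n \<and>
      w c < w d \<and> w d < w a \<and> w a < w b" by blast
next
  assume "\<exists>a b c d. 1 \<le> a \<and> a < b \<and> b < c \<and> c < d \<and> d \<le> n \<and> w c < w d \<and> w d < w a \<and> w a < w b"
  then obtain a b c d where "1 \<le> a" "a < b" "b < c" "c < d" "d \<le> n"
    "w c < w d" "w d < w a" "w a < w b" by blast
  then show "contains_pattern n w [3, 4, 1, 2]"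
    unfolding contains_pattern_def
    by (intro exI[of _ "\<lambda>i. [a, b, c, d] ! i"])
      (auto simp: strict_mono_on_def less_Suc_eq eval_nat_numeral)
qed

text \<open>Only \<open>simple_refl i\<close> moves points across the cut between \<open>i\<close>
  and \<open>Suc i\<close>.\<close>

lemma word_prod_le_iff:
  assumes "i \<notin> set xs"
  shows "word_prod xs x \<le> i \<longleftrightarrow> x \<le> i"
  using assms by (induction xs) (auto simp: simple_refl_apply split: if_splits)

lemma distinct_word_boolean:
  assumes "distinct xs"
  shows "boolean_perm n (word_prod xs)"
  using assms
proof (induction xs)
  case Nil
  then show ?case unfolding boolean_perm_def contains_321_iff contains_3412_iff by auto
next
  case (Cons i xs)
  define u where "u = word_prod xs"
  define v where "v = word_prod (i # xs)"
  have v: "v x = (if u x = i then Suc i else if u x = Suc i then i else u x)" for x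
    by (simp add: v_def u_def simple_refl_apply)
  have le: "u x \<le> i \<longleftrightarrow> x \<le> i" for x
    using word_prod_le_iff[of i xs x] Cons.prems by (simp add: u_def)
  \<comment> \<open>Composing with the reflection only exchanges the values \<open>i\<close> and \<open>i + 1\<close>, whose positions
    under \<open>u\<close> lie on different sides of the cut after \<open>i\<close>; so a new inversion cannot take part
    in either pattern.\<close>
  have bu: "boolean_perm n u" using Cons by (simp add: u_def)
  have "\<not> contains_pattern n v [3, 2, 1]"
  proof
    assume "contains_pattern n v [3, 2, 1]"
    then obtain a b c where o: "1 \<le> a" "a < b" "b < c" "c \<le> n" and vv: "v c < v b" "v b < v a"
      unfolding contains_321_iff by blast
    have "u c < u b" "u b < u a"
      using vv o le[of a] le[of b] le[of c] unfolding v by (auto split: if_splits)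
    then show False using bu o unfolding boolean_perm_def contains_321_iff by blast
  qed
  moreover have "\<not> contains_pattern n v [3, 4, 1, 2]"
  proof
    assume "contains_pattern n v [3, 4, 1, 2]"
    then obtain a b c d where o: "1 \<le> a" "a < b" "b < c" "c < d" "d \<le> n"
      and vv: "v c < v d" "v d < v a" "v a < v b"
      unfolding contains_3412_iff by blast
    have "u c < u d" "u d < u a" "u a < u b"
      using vv o le[of a] le[of b] le[of c] le[of d] unfolding v by (auto split: if_splits)
    then show False using bu o unfolding boolean_perm_def contains_3412_iff by blast
  qed
  ultimately show ?case unfolding boolean_perm_def v_def by blast
qed

section \<open>Crossings of a cut and multiplicities of letters\<close>

definition crossings :: "nat \<Rightarrow> (nat \<Rightarrow> nat) \<Rightarrow> nat set" where
  "crossings k w = {x \<in> {1..k}. k < w x}"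

lemma finite_crossings [simp]: "finite (crossings k w)"
  by (simp add: crossings_def)

text \<open>There are \<open>k\<close> points in \<open>{1..k}\<close> and also \<open>k\<close>
  points whose value is at most \<open>k\<close>; both counts result from removing the points common
  to these two sets.\<close>

lemma card_crossings_sym:
  assumes "w permutes {1..n}" "k \<le> n"
  shows "card (crossings k w) = card {x \<in> {Suc k..n}. w x \<le> k}"
proof -
  let ?A = "{x \<in> {1..k}. w x \<le> k}"
  have "w ` {x \<in> {1..n}. w x \<le> k} = {1..k}"
  proof (intro equalityI subsetI)
    fix y assume "y \<in> {1..k}"
    then have "y \<in> w ` {1..n}" "y \<le> k" using assms(2) permutes_image[OF assms(1)] by auto
    then show "y \<in> w ` {x \<in> {1..n}. w x \<le> k}" by blast
  next
    fix y assume "y \<in> w ` {x \<in> {1..n}. w x \<le> k}"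
    then have "y \<in> w ` {1..n}" "y \<le> k" by auto
    then show "y \<in> {1..k}" using permutes_image[OF assms(1)] by auto
  qed
  moreover have "inj_on w {x \<in> {1..n}. w x \<le> k}"
    using permutes_inj[OF assms(1)] by (rule inj_on_subset) auto
  ultimately have "card {x \<in> {1..n}. w x \<le> k} = k"
    by (metis card_atLeastAtMost card_image diff_Suc_1)
  moreover have "{x \<in> {1..n}. w x \<le> k} = ?A \<union> {x \<in> {Suc k..n}. w x \<le> k}"
    using assms(2) by auto
  moreover have "card (?A \<union> {x \<in> {Suc k..n}. w x \<le> k}) = card ?A + card {x \<in> {Suc k..n}. w x \<le> k}"
    by (rule card_Un_disjoint) auto
  moreover have "card (?A \<union> crossings k w) = card ?A + card (crossings k w)"
    by (rule card_Un_disjoint) (auto simp: crossings_def)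
  moreover have "?A \<union> crossings k w = {1..k}"
    by (auto simp: crossings_def)
  ultimately show ?thesis by simp
qed

text \<open>For \<open>i \<noteq> k\<close> the reflection maps \<open>{1..k}\<close> to itself and
  so carries the two sets into each other; \<open>1 \<le> i\<close> keeps \<open>1\<close> from
  being sent to \<open>0\<close>.\<close>

lemma card_crossings_comp_simple_refl:
  assumes "k \<noteq> i" "1 \<le> i"
  shows "card (crossings k (w \<circ> simple_refl i)) = card (crossings k w)"
proof (rule card_bij_eq[of "simple_refl i" _ _ "simple_refl i"])
  show "inj_on (simple_refl i) (crossings k (w \<circ> simple_refl i))" "inj_on (simple_refl i) (crossings k w)"
    by (auto simp: simple_refl_apply inj_on_def split: if_splits)
  show "simple_refl i ` crossings k (w \<circ> simple_refl i) \<subseteq> crossings k w"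
    "simple_refl i ` crossings k w \<subseteq> crossings k (w \<circ> simple_refl i)"
    using assms by (auto simp: simple_refl_apply crossings_def)
qed simp_all

text \<open>Induction over prefixes: appending \<open>i\<close> leaves the number of crossings of
  every other cut unchanged, while avoidance of 321 makes it add a crossing of the cut after
  \<open>i\<close>.\<close>

lemma count_le_card_crossings:
  assumes "reduced_word n (word_prod xs) xs" "\<not> contains_pattern n (word_prod xs) [3, 2, 1]"
  shows "count (mset xs) k \<le> card (crossings k (word_prod xs))"
  using assms
proof (induction xs rule: rev_induct)
  case (snoc i xs)
  define u where "u = word_prod xs"
  define v where "v = u \<circ> simple_refl i"
  have i: "1 \<le> i" "Suc i \<le> n"
    using reduced_word_subset[OF snoc.prems(1)] by auto
  have "v permutes {1..n}"
    using word_prod_permutes[OF reduced_word_subset[OF snoc.prems(1)]] by (simp add: u_def v_def)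
  note sym = card_crossings_sym[OF this, of i]
  have asc: "u i < u (Suc i)"
    using reduced_word_snoc_less[OF snoc.prems(1)] by (simp add: u_def)
  have v: "v i = u (Suc i)" "v (Suc i) = u i"
    by (simp_all add: v_def simple_refl_apply)
  have no321: "\<not> (1 \<le> a \<and> a < b \<and> b < c \<and> c \<le> n \<and> v c < v b \<and> v b < v a)" for a b c
    using snoc.prems(2) unfolding contains_321_iff v_def u_def by auto
  \<comment> \<open>Since \<open>i\<close> is an ascent of \<open>u\<close>, it is never an
    inversion of \<open>u\<close> with \<open>Suc i\<close>, so \<open>simple_refl i\<close> keeps
    the positions of a 321 in \<open>u\<close> in order and yields a 321 in
    \<open>v\<close>.\<close>
  have "\<not> contains_pattern n u [3, 2, 1]"
  proof
    assume "contains_pattern n u [3, 2, 1]"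
    then obtain a b c where o: "1 \<le> a" "a < b" "b < c" "c \<le> n" "u c < u b" "u b < u a"
      unfolding contains_321_iff by blast
    have "simple_refl i a < simple_refl i b" "simple_refl i b < simple_refl i c"
      using o asc by (auto simp: simple_refl_apply)
    moreover have "1 \<le> simple_refl i a" "simple_refl i c \<le> n"
      using o i by (auto simp: simple_refl_apply)
    moreover have "v (simple_refl i x) = u x" for x
      by (simp add: v_def simple_refl_apply)
    ultimately show False using no321[of "simple_refl i a" "simple_refl i b" "simple_refl i c"] o
      by simp
  qed
  then have IH: "count (mset xs) k \<le> card (crossings k u)"
    using snoc.IH reduced_word_appendD[OF snoc.prems(1)] by (simp add: u_def)
  show ?case
  proof (cases "k = i")
    case False
    then show ?thesis
      using IH card_crossings_comp_simple_refl[of k i u] i by (simp add: u_def comp_def)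
  next
    case True
    \<comment> \<open>Otherwise \<open>v i\<close> and \<open>v (Suc i)\<close> both exceed
      \<open>i\<close>. A crossing at \<open>i\<close> is balanced by some \<open>c\<close> beyond
      the cut with \<open>v c \<le> i\<close>, and \<open>i\<close>, \<open>Suc i\<close>,
      \<open>c\<close> form a 321.\<close>
    have "u i \<le> i"
    proof (rule ccontr)
      assume "\<not> u i \<le> i"
      then have "i \<in> crossings i v"
        using asc i by (simp add: crossings_def v)
      then have "card {x \<in> {Suc i..n}. v x \<le> i} \<noteq> 0"
        using sym i by (metis Suc_leD card_0_eq empty_iff finite_crossings)
      then obtain c where "c \<in> {x \<in> {Suc i..n}. v x \<le> i}"
        by (metis card.empty ex_in_conv)
      then have c: "Suc i \<le> c" "c \<le> n" "v c \<le> i" by auto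
      with \<open>\<not> u i \<le> i\<close> have "c \<noteq> Suc i" using v by auto
      with c \<open>\<not> u i \<le> i\<close> asc i no321[of i "Suc i" c] show False by (simp add: v)
    qed
    \<comment> \<open>Dually, a point \<open>c < i\<close> with \<open>v c > i\<close> would form a
      321 with \<open>i\<close> and \<open>Suc i\<close>.\<close>
    moreover have "i < u (Suc i)"
    proof (rule ccontr)
      assume *: "\<not> i < u (Suc i)"
      then have "Suc i \<in> {x \<in> {Suc i..n}. v x \<le> i}"
        using asc i by (simp add: v)
      then have "card (crossings i v) \<noteq> 0"
        using sym i by auto
      then obtain c where "c \<in> crossings i v"
        by (metis card.empty ex_in_conv)
      then have c: "1 \<le> c" "c \<le> i" "i < v c" by (auto simp: crossings_def)
      with * have "c \<noteq> i" using v by auto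
      with c * asc i no321[of c i "Suc i"] show False by (simp add: v)
    qed
    ultimately have "crossings i v = insert i (crossings i u)" "i \<notin> crossings i u"
      using i by (auto simp: crossings_def v_def simple_refl_apply split: if_splits)
    then have "card (crossings i v) = Suc (card (crossings i u))" by simp
    then show ?thesis using IH True by (simp add: v_def u_def comp_def)
  qed
qed simp

lemma card_ge_2_obtain_less:
  fixes A :: "nat set"
  assumes "2 \<le> card A"
  obtains a b where "a \<in> A" "b \<in> A" "a < b"
proof -
  obtain a b where "a \<in> A" "b \<in> A" "a \<noteq> b"
    using assms by (metis card_le_Suc0_iff_eq card.infinite not_less_eq_eq numeral_2_eq_2 zero_le)
  then show thesis using that by (metis linorder_neqE_nat)
qed

text \<open>A repeated letter \<open>k\<close> forces two upward crossings of the cut after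
  \<open>k\<close>, hence two downward ones. Avoidance of 321 makes the values of each pair
  increase, and the four points form a 3412.\<close>

lemma boolean_reduced_word_distinct:
  assumes "reduced_word n w xs" "boolean_perm n w"
  shows "distinct xs"
proof (rule ccontr)
  have w: "w = word_prod xs" and sub: "set xs \<subseteq> {1..<n}"
    using assms by (auto simp: reduced_word_def is_word_def)
  have perm: "w permutes {1..n}" using w sub word_prod_permutes by simp
  assume "\<not> distinct xs"
  then obtain k where k: "count (mset xs) k \<ge> 2"
    by (auto simp: distinct_count_atmost_1 split: if_splits)
      (metis One_nat_def Suc_1 Suc_leI count_greater_zero_iff nat_less_le set_mset_mset)
  then have "k \<in> set xs" by (metis count_mset_0_iff not_numeral_le_zero)
  then have kn: "k \<le> n" using sub by auto
  have no321: "\<not> (1 \<le> a \<and> a < b \<and> b < c \<and> c \<le> n \<and> w c < w b \<and> w b < w a)" for a b c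
    using assms(2) unfolding boolean_perm_def contains_321_iff by blast
  have c2: "2 \<le> card (crossings k w)"
    using count_le_card_crossings[of n xs k] k assms w by (simp add: boolean_perm_def)
  then obtain a b where "a \<in> crossings k w" "b \<in> crossings k w" "a < b"
    by (rule card_ge_2_obtain_less)
  then have ab: "1 \<le> a" "a < b" "b \<le> k" "k < w a" "k < w b" by (auto simp: crossings_def)
  obtain c d where "c \<in> {x \<in> {Suc k..n}. w x \<le> k}" "d \<in> {x \<in> {Suc k..n}. w x \<le> k}" "c < d"
    using c2 card_ge_2_obtain_less unfolding card_crossings_sym[OF perm kn] by blast
  then have cd: "k < c" "c < d" "d \<le> n" "w c \<le> k" "w d \<le> k" by auto
  have "w a \<noteq> w b" "w c \<noteq> w d"
    using ab cd permutes_inj[OF perm] by (auto dest: injD)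
  then have "w a < w b" "w c < w d"
    using no321[of a b c] no321[of a c d] ab cd by linarith+
  then have "contains_pattern n w [3, 4, 1, 2]"
    unfolding contains_3412_iff using ab cd
    by (intro exI[of _ a] exI[of _ b] exI[of _ c] exI[of _ d]) auto
  then show False using assms(2) by (simp add: boolean_perm_def)
qed

section \<open>First occurrences of letters\<close>

lemma commutation_move_mset: "commutation_move xs ys \<Longrightarrow> mset xs = mset ys"
  by (induction rule: commutation_move.induct) simp

lemma commutation_moves_mset: "commutation_move\<^sup>*\<^sup>* xs ys \<Longrightarrow> mset xs = mset ys"
  by (induction rule: rtranclp_induct) (auto dest: commutation_move_mset)

text \<open>This invariant is what rules out braid moves, which change the multiset of
  letters.\<close>

lemma fully_commutative_mset:
  assumes "fully_commutative n w" "reduced_word n w xs" "reduced_word n w ys"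
  shows "mset xs = mset ys"
  using assms commutation_moves_mset unfolding fully_commutative_def by blast

text \<open>Suppose \<open>k\<close> is missing. If the other neighbour \<open>k'\<close> is missing
  too, the two \<open>j\<close> meet and cancel; if it occurs once, a braid move becomes possible;
  if it occurs more often, induction puts a \<open>j\<close> between two of its occurrences.\<close>

lemma neighbour_between:
  assumes "fully_commutative n w" "reduced_word n w (us @ j # xs @ j # vs)"
    and "j \<notin> set xs" "k = Suc j \<or> j = Suc k"
  shows "k \<in> set xs"
  using assms(2-4)
proof (induction "length xs" arbitrary: us xs vs j k rule: less_induct)
  case less
  note red = less.prems(1)
  have w: "w = word_prod (us @ j # xs @ j # vs)" by (rule reduced_word_eq[OF red])
  have sub: "set (us @ j # xs @ j # vs) \<subseteq> {1..<n}" by (rule reduced_word_subset[OF red])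
  \<comment> \<open>The other neighbour of \<open>j\<close>; letters are at least \<open>1\<close>,
    so \<open>j - 1\<close> is a true predecessor.\<close>
  define k' where "k' = (if k = Suc j then j - 1 else Suc j)"
  have k': "k' = Suc j \<or> j = Suc k'" "\<And>i. i = Suc j \<or> j = Suc i \<Longrightarrow> i = k \<or> i = k'" "k' \<noteq> j"
    using less.prems(3) sub by (auto simp: k'_def)
  show ?case
  proof (rule ccontr)
    assume k: "k \<notin> set xs"
    have comm: "word_prod ys \<circ> simple_refl j = simple_refl j \<circ> word_prod ys"
      if "set ys \<subseteq> set xs" "k' \<notin> set ys" for ys
      using that k k'(2) by (intro word_prod_comm) blast
    show False
    proof (cases "k' \<in> set xs")
      case False
      have "word_prod (j # xs @ j # vs) = simple_refl j \<circ> (word_prod xs \<circ> simple_refl j) \<circ> word_prod vs"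
        by (simp add: o_assoc)
      also have "\<dots> = (simple_refl j \<circ> simple_refl j) \<circ> word_prod (xs @ vs)"
        unfolding comm[OF order_refl False] by (simp only: o_assoc word_prod_append)
      finally have "word_prod (us @ j # xs @ j # vs) = word_prod (us @ xs @ vs)" by simp
      then have "length (us @ j # xs @ j # vs) \<le> length (us @ xs @ vs)"
        using red sub w by (intro reduced_word_length_le[of n]) auto
      then show False by simp
    next
      case True
      then obtain ys zs where xs: "xs = ys @ k' # zs" "k' \<notin> set ys"
        by (meson split_list_first)
      show False
      proof (cases "k' \<in> set zs")
        case True
        then obtain z1 z2 where zs: "zs = z1 @ k' # z2" "k' \<notin> set z1"
          by (meson split_list_first)
        have "j \<in> set z1"
        \<comment> \<open>The roles are exchanged: \<open>k'\<close> is the repeated letter and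
          \<open>j\<close> its neighbour.\<close>
        proof (rule less.hyps)
          show "reduced_word n w ((us @ j # ys) @ k' # z1 @ k' # (z2 @ j # vs))"
            using red by (simp add: xs zs)
        qed (use xs zs k' in auto)
        then show False using less.prems(2) by (simp add: xs zs)
      next
        case False
        have "word_prod (j # xs @ j # vs) =
            (simple_refl j \<circ> word_prod ys) \<circ> simple_refl k' \<circ> (word_prod zs \<circ> simple_refl j) \<circ> word_prod vs"
          by (simp add: o_assoc xs)
        also have "\<dots> = word_prod ys \<circ> (simple_refl j \<circ> (simple_refl k' \<circ> simple_refl j)) \<circ> word_prod (zs @ vs)"
        proof -
          have "word_prod ys \<circ> simple_refl j = simple_refl j \<circ> word_prod ys"
            "word_prod zs \<circ> simple_refl j = simple_refl j \<circ> word_prod zs"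
            using comm[of ys] comm[of zs] xs False by auto
          then show ?thesis by (simp only: o_assoc word_prod_append)
        qed
        also have "\<dots> = word_prod ys \<circ> (simple_refl k' \<circ> (simple_refl j \<circ> simple_refl k')) \<circ> word_prod (zs @ vs)"
          using simple_refl_braid[of k' j] k'(1) by auto
        finally have "word_prod (us @ j # xs @ j # vs) = word_prod (us @ ys @ [k', j, k'] @ zs @ vs)"
          by (simp add: o_assoc)
        then have "reduced_word n w (us @ ys @ [k', j, k'] @ zs @ vs)"
          using red by (auto simp: reduced_word_def is_word_def xs)
        \<comment> \<open>The braid move has traded one \<open>j\<close> for one
          \<open>k'\<close>.\<close>
        from fully_commutative_mset[OF assms(1) red this] have "j = k'"
          by (simp add: xs)
        then show False using k' by simp
      qed
    qed
  qed
qed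

section \<open>The subword of first occurrences\<close>

text \<open>\<open>remdups\<close> keeps last occurrences, hence the two reversals.\<close>

definition first_occs :: "'a list \<Rightarrow> 'a list" where
  "first_occs xs = rev (remdups (rev xs))"

lemma first_occs_Nil [simp]: "first_occs [] = []"
  by (simp add: first_occs_def)

lemma first_occs_snoc [simp]:
  "first_occs (xs @ [a]) = (if a \<in> set xs then first_occs xs else first_occs xs @ [a])"
  by (simp add: first_occs_def)

lemma set_first_occs [simp]: "set (first_occs xs) = set xs"
  by (simp add: first_occs_def)

lemma distinct_first_occs [simp]: "distinct (first_occs xs)"
  by (simp add: first_occs_def)

lemma first_occs_append_distinct:
  assumes "distinct xs" "set ys \<subseteq> set xs"
  shows "first_occs (xs @ ys) = xs"
  using assms(2)
proof (induction ys rule: rev_induct)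
  case Nil
  then show ?case using assms(1) by (simp add: first_occs_def distinct_remdups_id)
next
  case (snoc a ys)
  then show ?case using first_occs_snoc[of "xs @ ys" a] by auto
qed

text \<open>Once repetitions are dropped, either the commuting pair survives as an adjacent pair, or
  one of its letters is gone and the two subwords coincide.\<close>

lemma commutation_move_first_occs:
  assumes "commutation_move xs ys"
  shows "word_prod (first_occs xs) = word_prod (first_occs ys)"
  using assms
proof cases
  case (1 i j us vs)
  have comm: "simple_refl i \<circ> simple_refl j = simple_refl j \<circ> simple_refl i"
    using 1 by (intro simple_refl_comm) auto
  have "word_prod (first_occs (us @ [i, j] @ vs)) = word_prod (first_occs (us @ [j, i] @ vs))"
  proof (induction vs rule: rev_induct)
    case Nil
    show ?case
      using first_occs_snoc[of "us @ [i]" j] first_occs_snoc[of "us @ [j]" i] comm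
      by (auto simp flip: o_assoc)
  next
    case (snoc a vs)
    then show ?case
      using first_occs_snoc[of "us @ [i, j] @ vs" a] first_occs_snoc[of "us @ [j, i] @ vs" a]
      by auto
  qed
  then show ?thesis using 1 by simp
qed

lemma commutation_moves_first_occs:
  "commutation_move\<^sup>*\<^sup>* xs ys \<Longrightarrow> word_prod (first_occs xs) = word_prod (first_occs ys)"
  by (induction rule: rtranclp_induct) (auto dest: commutation_move_first_occs)

lemma count_ge_2_split:
  assumes "2 \<le> count (mset xs) b"
  obtains us ys vs where "xs = us @ b # ys @ b # vs" "b \<notin> set ys"
proof -
  have "b \<in> set xs" using assms by (metis count_mset_0_iff not_numeral_le_zero)
  then obtain us zs where xs: "xs = us @ b # zs" "b \<notin> set us" by (meson split_list_first)
  have "count (mset us) b = 0" using xs(2) by (metis count_mset_0_iff)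
  then have "count (mset zs) b \<noteq> 0" using assms xs(1) by (simp del: count_mset_0_iff)
  then have "b \<in> set zs" by (metis count_mset_0_iff)
  then obtain ys vs where "zs = ys @ b # vs" "b \<notin> set ys" by (meson split_list_first)
  with xs that show thesis by blast
qed

text \<open>Induction over prefixes of a reduced word of \<open>w\<close>: a repeated letter joins
  the end of \<open>rs\<close>, a new one is moved left past \<open>rs\<close>. The multiset
  equation shows that letters of \<open>rs\<close> are repeated in \<open>xs\<close>, and later that
  the rearranged word is reduced.\<close>

lemma first_occs_left_factor:
  assumes "fully_commutative n w" "reduced_word n w (xs @ vs)"
  shows "\<exists>rs. word_prod xs = word_prod (first_occs xs @ rs) \<and> mset xs = mset (first_occs xs @ rs)"
  using assms(2)
proof (induction xs arbitrary: vs rule: rev_induct)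
  case (snoc a xs)
  have "reduced_word n w (xs @ a # vs)" using snoc.prems by simp
  from snoc.IH[OF this] obtain rs where rs: "word_prod xs = word_prod (first_occs xs @ rs)"
      "mset xs = mset (first_occs xs @ rs)"
    by blast
  show ?case
  proof (cases "a \<in> set xs")
    case True
    then show ?thesis using rs by (intro exI[of _ "rs @ [a]"]) (simp add: o_assoc)
  next
    case False
    \<comment> \<open>A neighbour of \<open>a\<close> in \<open>rs\<close> occurs twice in \<open>xs\<close>, which would force \<open>a\<close> to occur in between.\<close>
    have "\<forall>b\<in>set rs. b \<noteq> Suc a \<and> a \<noteq> Suc b"
    proof (intro ballI)
      fix b assume b: "b \<in> set rs"
      then have "b \<in> set (first_occs xs)" using mset_eq_setD[OF rs(2)] by auto
      then have "count (mset (first_occs xs)) b > 0" "count (mset rs) b > 0"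
        using b by (metis count_greater_zero_iff set_mset_mset)+
      then have "2 \<le> count (mset xs) b" unfolding rs(2) mset_append count_union by linarith
      then obtain p ys q where xs: "xs = p @ b # ys @ b # q" "b \<notin> set ys"
        by (rule count_ge_2_split)
      then have "reduced_word n w (p @ b # ys @ b # (q @ a # vs))" using snoc.prems by simp
      then show "b \<noteq> Suc a \<and> a \<noteq> Suc b"
        using neighbour_between[OF assms(1), of p b ys "q @ a # vs" a] xs False by auto
    qed
    then have "word_prod rs \<circ> simple_refl a = simple_refl a \<circ> word_prod rs"
      by (rule word_prod_comm)
    then have "word_prod (xs @ [a]) = word_prod ((first_occs xs @ [a]) @ rs)"
      using rs(1) by (simp flip: o_assoc)
    then show ?thesis using rs(2) False by (intro exI[of _ rs]) auto
  qed
qed simp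

text \<open>Any reduced word of the left factor, followed by \<open>ys\<close>, is again a reduced
  word of \<open>w\<close>, so the multisets can be compared. Taking \<open>ys\<close> empty gives
  the support of \<open>w\<close> itself.\<close>

lemma supp_left_factor:
  assumes "fully_commutative n w" "reduced_word n w (xs @ ys)"
  shows "supp n (word_prod xs) = set xs"
proof -
  have red: "reduced_word n (word_prod xs) xs"
    using assms reduced_word_appendD(1) reduced_word_eq by blast
  have "set zs = set xs" if zs: "reduced_word n (word_prod xs) zs" for zs
  proof -
    have "reduced_word n w (zs @ ys)"
      using assms(2) zs red by (auto simp: reduced_word_def is_word_def)
    from fully_commutative_mset[OF assms this] have "mset xs = mset zs" by simp
    then show ?thesis by (metis set_mset_mset)
  qed
  with red show ?thesis unfolding supp_def by blast
qed

section \<open>Existence and uniqueness of the boolean left factor\<close>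

theorem theorem3p2:
  fixes n :: nat and w :: "nat \<Rightarrow> nat"
  assumes "w permutes {1..n}"
    and "fully_commutative n w"
  shows "\<exists>!what. what permutes {1..n} \<and>
           (\<exists>w'. w' permutes {1..n} \<and>
              w = what \<circ> w' \<and>
              perm_len n w = perm_len n what + perm_len n w' \<and>
              boolean_perm n what \<and>
              supp n what = supp n w)"
proof -
  obtain xs where red: "reduced_word n w xs" using ex_reduced_word[OF assms(1)] by blast
  obtain rs where rs: "word_prod xs = word_prod (first_occs xs @ rs)"
      "mset xs = mset (first_occs xs @ rs)"
    using first_occs_left_factor[OF assms(2), of xs "[]"] red by auto
  have red': "reduced_word n w (first_occs xs @ rs)"
    using reduced_word_transfer[OF red] rs by simp
  have w: "w = word_prod (first_occs xs @ rs)" by (rule reduced_word_eq[OF red'])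
  note parts = reduced_word_appendD[OF red'[unfolded w]]
  show ?thesis
  proof (rule ex1I[of _ "word_prod (first_occs xs)"], intro conjI exI[of _ "word_prod rs"])
    show "word_prod (first_occs xs) permutes {1..n}" "word_prod rs permutes {1..n}"
      using parts word_prod_permutes reduced_word_subset by blast+
    show "w = word_prod (first_occs xs) \<circ> word_prod rs" using w by simp
    show "perm_len n w = perm_len n (word_prod (first_occs xs)) + perm_len n (word_prod rs)"
      using red' parts by (simp add: reduced_word_def)
    show "boolean_perm n (word_prod (first_occs xs))" by (simp add: distinct_word_boolean)
    show "supp n (word_prod (first_occs xs)) = supp n w"
      using supp_left_factor[OF assms(2) red'] supp_left_factor[OF assms(2), of xs "[]"] red
        reduced_word_eq[OF red] by simp
  next
    fix u
    assume "u permutes {1..n} \<and> (\<exists>w'. w' permutes {1..n} \<and> w = u \<circ> w' \<and>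
        perm_len n w = perm_len n u + perm_len n w' \<and> boolean_perm n u \<and> supp n u = supp n w)"
    then obtain w' where u: "u permutes {1..n}" "w' permutes {1..n}" "w = u \<circ> w'"
        "perm_len n w = perm_len n u + perm_len n w'" "boolean_perm n u" "supp n u = supp n w"
      by blast
    obtain us vs where us: "reduced_word n u us" and vs: "reduced_word n w' vs"
      using ex_reduced_word u by meson
    have red_uv: "reduced_word n w (us @ vs)"
      using reduced_word_append[OF us vs] u by simp
    \<comment> \<open>Equality of supports means that \<open>vs\<close> brings no new
      letter.\<close>
    have "set us = set (us @ vs)"
      using supp_left_factor[OF assms(2) red_uv] supp_left_factor[OF assms(2), of "us @ vs" "[]"]
        red_uv u(6) reduced_word_eq[OF us] reduced_word_eq[OF red_uv] by simp
    then have "first_occs (us @ vs) = us"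
      using boolean_reduced_word_distinct[OF us u(5)] by (intro first_occs_append_distinct) auto
    \<comment> \<open>The product of first occurrences is constant along these commutations, so
      \<open>u\<close> agrees with the factor built from \<open>xs\<close>.\<close>
    moreover have "commutation_move\<^sup>*\<^sup>* (us @ vs) xs"
      using assms(2) red_uv red by (simp add: fully_commutative_def)
    ultimately show "u = word_prod (first_occs xs)"
      using commutation_moves_first_occs reduced_word_eq[OF us] by metis
  qed
qed

end
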